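(* Let $1<p<\infty$, $0<T<\infty$, and let $\nu\in L^1(0,T)$, $\nu>0$, be such that for some $0<\tau_0\le T$ the function $\nu$ is decreasing in $(0,\tau_0)$ and, if $\tau_0<T$, bounded in $(\tau_0,T)$. Then there exists a Young's function $A$ such that, for some $c_\nu>0$, $$\int_0^t\nu(\sigma)\,d\sigma\le c_\nu\,t\,A^{-1}\!\left(\frac1t\right)\qquad\forall t\in(0,\tau_0),$$ and such that $L^C(0,T)$ is strictly contained in $L^p(0,T)$, where $C$ is the Young's function defined by $$C^{-1}(x)=\int_0^x t^{-2+\frac1p}A^{-1}(t)\,dt,\qquad x\ge0.$$
   Context: A Young's function is a convex function $A:[0,\infty[\to[0,\infty[$ with $A(0)=0$ and $A(x)>0$ for $x>0$; it is strictly increasing and invertible, with inverse $A^{-1}$ defined on $[0,\infty[$. For a Young's function $A$, $\|f\|_{L^A(0,T)}=\inf\{\lambda>0:\int_0^T A(|f(t)|/\lambda)\,dt\le1\}$ (with $\inf\emptyset=+\infty$), and $L^A(0,T)$ is the set of real-valued measurable $f$ on $(0,T)$ with finite norm. "Decreasing" means non-increasing. It is part of the assertion that $A$ can be chosen so that the formula for $C^{-1}$ defines the inverse of a Young's function $C$. *)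

theory Defs
  imports "HOL-Analysis.Analysis"
begin

text \<open>
  Functions on \<open>[0,\<infinity>[\<close> and on \<open>(0,T)\<close> are represented by total functions on the reals; the values
  outside these sets are irrelevant to every notion below.
\<close>

definition young_function :: "(real \<Rightarrow> real) \<Rightarrow> bool" where
  "young_function A \<longleftrightarrow> convex_on {0..} A \<and> A 0 = 0 \<and> (\<forall>x>0. A x > 0)"

text \<open>A Young's function is a bijection of \<open>[0,\<infinity>[\<close> onto itself, so this is its genuine inverse there.\<close>

definition young_inv :: "(real \<Rightarrow> real) \<Rightarrow> real \<Rightarrow> real" where
  "young_inv A = inv_into {0..} A"

text \<open>The infimum is taken in the extended nonnegative reals, where \<open>Inf {} = \<infinity>\<close>.\<close>

definition luxemburg_norm :: "(real \<Rightarrow> real) \<Rightarrow> real \<Rightarrow> (real \<Rightarrow> real) \<Rightarrow> ennreal" where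
  "luxemburg_norm A T f =
     Inf {ennreal l | l. l > 0 \<and> (\<integral>\<^sup>+ t. ennreal (A (\<bar>f t\<bar> / l)) \<partial>lebesgue_on {0<..<T}) \<le> 1}"

text \<open>
  Neither of the following spaces is a quotient modulo null sets, and both are invariant under
  changing \<open>f\<close> on a null set or outside \<open>(0,T)\<close>; hence (strict) inclusion of these sets is the same
  as (strict) inclusion of the corresponding spaces of equivalence classes.
\<close>

definition orlicz_space :: "(real \<Rightarrow> real) \<Rightarrow> real \<Rightarrow> (real \<Rightarrow> real) set" where
  "orlicz_space A T = {f \<in> borel_measurable (lebesgue_on {0<..<T}). luxemburg_norm A T f < \<infinity>}"

definition Lp_space :: "real \<Rightarrow> real \<Rightarrow> (real \<Rightarrow> real) set" where
  "Lp_space p T = {f \<in> borel_measurable (lebesgue_on {0<..<T}).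
     integrable (lebesgue_on {0<..<T}) (\<lambda>t. \<bar>f t\<bar> powr p)}"

end

theory Submission
  imports Defs
begin

text \<open>
  Both Young's functions are constructed through their inverses. An unbounded positive concave
  function on \<open>[0,\<infinity>[\<close> that vanishes continuously at \<open>0\<close> is the inverse of a Young's function
  (\<open>inverse_of_concave_is_young_function\<close>), so it suffices to choose \<open>B = A\<inverse>\<close>.

  The estimate that is required for \<open>\<nu>\<close> holds if \<open>B x \<ge> x N (1 / x)\<close> for large \<open>x\<close>, where \<open>N\<close> is the
  primitive of \<open>\<nu>\<close>, and the idea is to take this lower bound itself as \<open>B\<close>. Since \<open>\<nu>\<close> decreases,
  \<open>N\<close> is concave, and hence so is its perspective \<open>x N (1 / x)\<close>. Two modifications of \<open>\<nu>\<close> make this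
  work. Cutting it off at \<open>\<tau>\<^sub>0\<close> keeps it decreasing on the whole half-line and makes \<open>B\<close> linear near
  \<open>0\<close>. Adding \<open>t powr (q - 1)\<close> with \<open>q = 1 / (2 p)\<close> makes \<open>B\<close> and the primitive \<open>D = C\<inverse>\<close> below
  unbounded even if \<open>\<nu>\<close> is small; any \<open>q\<close> strictly between \<open>0\<close> and \<open>1 / p\<close> has this effect.

  With \<open>N\<close> now the primitive of the modified weight and \<open>g t = N (1 / t) = B t / t\<close>, the
  integrand that defines \<open>D\<close> is \<open>t powr (1 / p - 1) * g t\<close>, again decreasing, so \<open>D\<close> is
  concave. The function \<open>g\<close> is bounded, hence \<open>D x \<le> k * x powr (1 / p)\<close>, that is,
  \<open>C x \<ge> (x / k) powr p\<close>, and \<open>L\<^sup>C\<close> is contained in \<open>L\<^sup>p\<close>. Because \<open>\<nu>\<close> is integrable, \<open>g\<close> tends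
  to \<open>0\<close> at infinity, so \<open>D x\<close> is \<open>o(x powr (1 / p))\<close> and \<open>C x / x powr p\<close> is unbounded; a
  gliding-hump function then lies in \<open>L\<^sup>p\<close> but not in \<open>L\<^sup>C\<close> (\<open>exists_Lp_not_orlicz\<close>).
\<close>

section \<open>Concave functions on the half-line and their inverses\<close>

text \<open>
  Average the supporting line at the intermediate point over the two end points. An intermediate
  point of two distinct points of \<open>[0,\<infinity>[\<close> is positive, so the boundary point \<open>0\<close> demands no line.
\<close>

lemma concave_on_if_supporting_lines:
  fixes F :: "real \<Rightarrow> real"
  assumes "\<And>c. c > 0 \<Longrightarrow> \<exists>m. \<forall>x\<ge>0. F x \<le> F c + m * (x - c)"
  shows "concave_on {0..} F"
proof (rule concave_on_linorderI)
  fix t x y :: real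
  assume t: "0 < t" "t < 1" and xy: "x \<in> {0..}" "y \<in> {0..}" "x < y"
  define c where "c = (1 - t) * x + t * y"
  have "c > 0"
    unfolding c_def using t xy by (intro add_nonneg_pos mult_nonneg_nonneg mult_pos_pos) auto
  then obtain m where m: "\<forall>x\<ge>0. F x \<le> F c + m * (x - c)"
    using assms by blast
  have "(1 - t) * F x + t * F y \<le> (1 - t) * (F c + m * (x - c)) + t * (F c + m * (y - c))"
    using m t xy by (intro add_mono mult_left_mono) auto
  also have "\<dots> = F c + m * ((1 - t) * x + t * y - c)"
    by (simp add: algebra_simps)
  finally show "(1 - t) * F x + t * F y \<le> F ((1 - t) *\<^sub>R x + t *\<^sub>R y)"
    by (simp add: c_def)
qed simp

text \<open>
  A concave function that tends to infinity is strictly increasing, since a drop would force it to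
  stay below a previous value. With continuity it is a bijection of \<open>[0,\<infinity>[\<close>, and the inverse of an
  increasing concave function is convex.
\<close>

lemma inverse_of_concave_is_young_function:
  fixes B :: "real \<Rightarrow> real"
  assumes conc: "concave_on {0..} B" and zero: "B 0 = 0" and pos: "\<forall>x>0. B x > 0"
    and lim0: "(B \<longlongrightarrow> 0) (at_right 0)" and top: "filterlim B at_top at_top"
  shows "young_function (inv_into {0..} B)"
    and "x \<ge> 0 \<Longrightarrow> young_inv (inv_into {0..} B) x = B x"
    and "x \<ge> 0 \<Longrightarrow> inv_into {0..} B (B x) = x"
    and "x \<ge> 0 \<Longrightarrow> inv_into {0..} B x \<ge> 0"
    and "x \<ge> 0 \<Longrightarrow> B (inv_into {0..} B x) = x"
proof -
  have B_less: "B a < B b" if ab: "0 \<le> a" "a < b" for a b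
  proof (rule ccontr)
    assume "\<not> B a < B b"
    have "eventually (\<lambda>x. B x > B a \<and> x > b) at_top"
      using top by (auto simp: filterlim_at_top_dense eventually_conj_iff eventually_gt_at_top)
    then obtain x where x: "B x > B a" "x > b"
      using eventually_happens'[OF trivial_limit_at_top_linorder] by blast
    \<comment> \<open>The weight that places \<open>b\<close> between \<open>a\<close> and \<open>x\<close>.\<close>
    define t where "t = (b - a) / (x - a)"
    have t: "0 < t" "t < 1"
      using ab x by (auto simp: t_def)
    have tx: "t * (x - a) = b - a"
      using ab x by (simp add: t_def)
    have "(1 - t) * B a + t * B x \<le> B ((1 - t) *\<^sub>R a + t *\<^sub>R x)"
      using concave_onD[OF conc] t ab x by simp
    also have "(1 - t) *\<^sub>R a + t *\<^sub>R x = b"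
      using tx by (simp add: algebra_simps)
    finally have "(1 - t) * B a + t * B x \<le> B a"
      using \<open>\<not> B a < B b\<close> by linarith
    then have "t * (B x - B a) \<le> 0"
      by (simp add: algebra_simps)
    moreover have "t * (B x - B a) > 0"
      using t x by simp
    ultimately show False by linarith
  qed
  then have B_less_iff: "B a < B b \<longleftrightarrow> a < b" if "0 \<le> a" "0 \<le> b" for a b
    using that by (metis not_less_iff_gr_or_eq)
  then have inj: "inj_on B {0..}"
    by (metis atLeast_iff inj_onI less_irrefl linorder_neqE_linordered_idom)
  have nonneg: "B x \<ge> 0" if "x \<ge> 0" for x
    using pos zero that by (cases "x = 0") (auto simp: less_imp_le)
  have cont: "continuous_on {0..} B"
  proof -
    have "convex_on {0<..} (\<lambda>x. - B x)"
      using conc unfolding concave_on_def by (rule convex_on_subset) auto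
    then have "continuous_on {0<..} (\<lambda>x. - B x)"
      by (intro convex_on_continuous) auto
    then have "continuous_on {0<..} B"
      using continuous_on_minus by fastforce
    then have "isCont B x" if "x > 0" for x
      using that continuous_on_eq_continuous_at[of "{0<..}" B] by auto
    then show ?thesis
      unfolding continuous_on_def using lim0 zero
      by (metis atLeast_iff at_within_Ici_at_right continuous_at_imp_continuous_at_within
          continuous_within less_eq_real_def)
  qed
  have surj: "\<exists>x\<ge>0. B x = y" if "y \<ge> 0" for y
  proof -
    have "eventually (\<lambda>x. B x \<ge> y \<and> x \<ge> 0) at_top"
      using top by (auto simp: filterlim_at_top eventually_conj_iff eventually_ge_at_top)
    then obtain x where "B x \<ge> y" "x \<ge> 0"
      using eventually_happens'[OF trivial_limit_at_top_linorder] by blast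
    then show ?thesis
      using IVT'[of B 0 y x] zero that continuous_on_subset[OF cont] by (metis atLeastAtMost_iff atLeast_iff subsetI)
  qed
  have img: "B ` {0..} = {0..}"
    using surj nonneg by force
  define A where "A = inv_into {0..} B"
  have A_nonneg: "A y \<ge> 0" if "y \<ge> 0" for y
    using that inv_into_into[of y B "{0..}"] img by (auto simp: A_def)
  have B_A: "B (A y) = y" if "y \<ge> 0" for y
    using that img by (simp add: A_def f_inv_into_f)
  have A_B: "A (B x) = x" if "x \<ge> 0" for x
    using that inj by (simp add: A_def)
  have "convex_on {0..} A"
  proof (rule convex_on_linorderI)
    fix t x y :: real
    assume t: "0 < t" "t < 1" and xy: "x \<in> {0..}" "y \<in> {0..}" "x < y"
    define z where "z = (1 - t) * x + t * y"
    define w where "w = (1 - t) * A x + t * A y"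
    have "z \<ge> 0" "w \<ge> 0"
      using t xy A_nonneg by (auto simp: z_def w_def)
    have "(1 - t) * B (A x) + t * B (A y) \<le> B ((1 - t) *\<^sub>R A x + t *\<^sub>R A y)"
      using concave_onD[OF conc, of t "A x" "A y"] t xy A_nonneg by simp
    then have "B (A z) \<le> B w"
      using B_A xy \<open>z \<ge> 0\<close> by (simp add: z_def w_def)
    then have "A z \<le> w"
      using B_less_iff[of w "A z"] A_nonneg \<open>z \<ge> 0\<close> \<open>w \<ge> 0\<close> by force
    then show "A ((1 - t) *\<^sub>R x + t *\<^sub>R y) \<le> (1 - t) * A x + t * A y"
      by (simp add: z_def w_def)
  qed simp
  moreover have "A 0 = 0"
    using A_B[of 0] zero by simp
  moreover have "A y > 0" if "y > 0" for y
    using A_nonneg[of y] B_A[of y] zero that by (cases "A y = 0") auto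
  ultimately show "young_function (inv_into {0..} B)"
    by (simp add: young_function_def A_def)
  show "x \<ge> 0 \<Longrightarrow> inv_into {0..} B (B x) = x" "x \<ge> 0 \<Longrightarrow> inv_into {0..} B x \<ge> 0"
    "x \<ge> 0 \<Longrightarrow> B (inv_into {0..} B x) = x"
    using A_B A_nonneg B_A by (simp_all add: A_def)
  show "young_inv (inv_into {0..} B) x = B x" if "x \<ge> 0"
  proof -
    have "inj_on A {0..}"
      by (metis B_A atLeast_iff inj_onI)
    then have "inv_into {0..} A (A (B x)) = B x"
      using that nonneg inv_into_f_f[of A "{0..}" "B x"] by simp
    moreover have "inv_into {0..} A x = B x"
      using calculation A_B that by simp
    ultimately show ?thesis
      by (simp add: young_inv_def A_def)
  qed
qed

section \<open>Primitives of decreasing functions\<close>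

definition primitive :: "(real \<Rightarrow> real) \<Rightarrow> real \<Rightarrow> real" where
  "primitive f x = integral\<^sup>L (lebesgue_on {0<..<x}) f"

lemma primitive_eq_indicator: "primitive f x = (LINT t|lebesgue. indicator {0<..<x} t * f t)"
  unfolding primitive_def by (subst integral_restrict_space) auto

lemma integrable_lebesgue_on_iff:
  fixes f :: "real \<Rightarrow> real"
  shows "integrable (lebesgue_on {0<..<x}) f \<longleftrightarrow>
    integrable lebesgue (\<lambda>t. indicator {0<..<x} t * f t)"
  by (subst integrable_restrict_space) auto

lemma primitive_0 [simp]: "primitive f 0 = 0"
  by (simp add: primitive_eq_indicator)

lemma primitive_mono:
  assumes "integrable (lebesgue_on {0<..<x}) f" "integrable (lebesgue_on {0<..<x}) g"
    and "\<And>t. 0 < t \<Longrightarrow> t < x \<Longrightarrow> f t \<le> g t"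
  shows "primitive f x \<le> primitive g x"
  unfolding primitive_def using assms by (intro integral_mono) auto

lemma primitive_mono_upper_limit:
  assumes "integrable (lebesgue_on {0<..<x}) f" "integrable (lebesgue_on {0<..<y}) f" "x \<le> y"
    and "\<And>t. t > 0 \<Longrightarrow> f t \<ge> 0"
  shows "primitive f x \<le> primitive f y"
  unfolding primitive_eq_indicator using assms
  by (intro integral_mono) (auto simp: integrable_lebesgue_on_iff indicator_def)

text \<open>
  The supporting line of a primitive has the value of the integrand as its slope. The estimate holds
  pointwise under the integral: the difference of the two indicators is positive only to the right
  of \<open>c\<close>, where \<open>f \<le> f c\<close>, and negative only to the left of \<open>c\<close>, where \<open>f \<ge> f c\<close>.
\<close>

lemma primitive_le_tangent:
  assumes anti: "antimono_on {0<..} f" and int: "\<And>x. integrable (lebesgue_on {0<..<x}) f"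
    and "c > 0" "x \<ge> 0"
  shows "primitive f x \<le> primitive f c + f c * (x - c)"
proof -
  let ?d = "\<lambda>t. indicator {0<..<x} t - indicator {0<..<c} t :: real"
  have int': "integrable lebesgue (\<lambda>t. indicator {0<..<y} t * f t)" for y
    using int by (simp add: integrable_lebesgue_on_iff)
  have ind: "integrable lebesgue (indicator {0<..<y} :: real \<Rightarrow> real)" for y :: real
    by (cases "y \<ge> 0") (auto intro!: integrable_real_indicator)
  have "primitive f x - primitive f c = (LINT t|lebesgue. ?d t * f t)"
    unfolding primitive_eq_indicator left_diff_distrib using int' by simp
  also have "\<dots> \<le> (LINT t|lebesgue. ?d t * f c)"
  proof (rule integral_mono)
    show "integrable lebesgue (\<lambda>t. ?d t * f t)"
      unfolding left_diff_distrib using int' by simp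
    show "integrable lebesgue (\<lambda>t. ?d t * f c)"
      using ind by (intro integrable_mult_left Bochner_Integration.integrable_diff)
    fix t
    have "f t \<le> f c" if "c \<le> t"
      using anti that \<open>c > 0\<close> by (auto simp: monotone_on_def)
    moreover have "f c \<le> f t" if "t \<le> c" "t > 0"
      using anti that \<open>c > 0\<close> by (auto simp: monotone_on_def)
    ultimately show "?d t * f t \<le> ?d t * f c"
      by (auto simp: indicator_def)
  qed
  also have "\<dots> = f c * (x - c)"
    using assms(3,4) ind by simp
  finally show ?thesis by linarith
qed

lemma integral_powr:
  fixes a x :: real
  assumes "a > 0"
  shows "integrable (lebesgue_on {0<..<x}) (\<lambda>t. t powr (a - 1))"
    and "x \<ge> 0 \<Longrightarrow> primitive (\<lambda>t. t powr (a - 1)) x = x powr a / a"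
proof -
  have *: "integrable (lebesgue_on {0<..<x}) (\<lambda>t. t powr (a - 1)) \<and>
    primitive (\<lambda>t. t powr (a - 1)) x = x powr a / a" if "x \<ge> 0" for x
  proof -
    have "((\<lambda>t. t powr (a - 1)) has_integral x powr (a - 1 + 1) / (a - 1 + 1)) {0..x}"
      by (rule has_integral_powr_from_0) (use assms that in auto)
    then have H: "((\<lambda>t. t powr (a - 1)) has_integral x powr a / a) {0<..<x}"
      by (simp add: has_integral_Icc_iff_Ioo)
    then have "set_integrable lebesgue {0<..<x} (\<lambda>t. t powr (a - 1))"
      by (intro nonnegative_absolutely_integrable_1) auto
    then have I: "integrable (lebesgue_on {0<..<x}) (\<lambda>t. t powr (a - 1))"
      by (simp add: integrable_lebesgue_on_iff set_integrable_def)
    then have "primitive (\<lambda>t. t powr (a - 1)) x = integral {0<..<x} (\<lambda>t. t powr (a - 1))"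
      unfolding primitive_def by (intro lebesgue_integral_eq_integral) auto
    with H I show ?thesis
      by (simp add: integral_unique)
  qed
  show "integrable (lebesgue_on {0<..<x}) (\<lambda>t. t powr (a - 1))"
    using *[of x] by (cases "x \<ge> 0") (auto simp: integrable_lebesgue_on_iff)
  show "x \<ge> 0 \<Longrightarrow> primitive (\<lambda>t. t powr (a - 1)) x = x powr a / a"
    using * by blast
qed

lemma antimono_on_borel_measurable:
  fixes f :: "real \<Rightarrow> real"
  assumes "antimono_on {0<..} f"
  shows "f \<in> borel_measurable (lebesgue_on {0<..<x})"
proof -
  have "mono_on {0<..} (\<lambda>t. - f t)"
    using assms by (auto simp: monotone_on_def)
  then have "(\<lambda>t. - f t) \<in> borel_measurable (restrict_space borel {0<..})"
    by (rule borel_measurable_mono_on_fnc)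
  then have "f \<in> borel_measurable (restrict_space borel {0<..})"
    using borel_measurable_uminus_eq by blast
  then have "(\<lambda>t. indicator {0<..} t * f t) \<in> borel_measurable borel"
    by (subst (asm) borel_measurable_restrict_space_iff) auto
  then have "(\<lambda>t. indicator {0<..} t * f t) \<in> borel_measurable (lebesgue_on {0<..<x})"
    by (intro measurable_restrict_space1 measurable_completion) simp
  then show ?thesis
    by (rule measurable_cong[THEN iffD1, rotated]) (auto simp: space_restrict_space)
qed

section \<open>The primitive of a power times a decreasing function\<close>

text \<open>
  The primitive inherits the size of \<open>g\<close> relative to \<open>x powr (1 / p)\<close>: from above through the bound
  \<open>K\<close>, and from below because \<open>g\<close> is at least \<open>g x\<close> on \<open>(0,x)\<close>. These give the behaviour at \<open>0\<close>
  and the divergence at infinity. For the smallness relative to \<open>x powr (1 / p)\<close> the decay of \<open>g\<close> is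
  first turned into one inequality on the whole half-line, which is then integrated.
\<close>

lemma powr_primitive_properties:
  fixes p K :: real and g :: "real \<Rightarrow> real"
  defines "f \<equiv> \<lambda>t. t powr (1 / p - 1) * g t"
  assumes "p > 1" and anti: "antimono_on {0<..} g"
    and g_bounds: "\<forall>t>0. 0 < g t \<and> g t \<le> K"
    and g_lim: "(g \<longlongrightarrow> 0) at_top"
    and g_top: "filterlim (\<lambda>x. x powr (1 / p) * g x) at_top at_top"
  shows "integrable (lebesgue_on {0<..<x}) f"
    and "concave_on {0..} (primitive f)"
    and "\<forall>x>0. primitive f x > 0"
    and "x \<ge> 0 \<Longrightarrow> primitive f x \<le> K * p * x powr (1 / p)"
    and "(primitive f \<longlongrightarrow> 0) (at_right 0)"
    and "filterlim (primitive f) at_top at_top"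
    and "\<epsilon> > 0 \<Longrightarrow> eventually (\<lambda>x. primitive f x \<le> \<epsilon> * x powr (1 / p)) at_top"
proof -
  have g_pos: "g t > 0" and g_le: "g t \<le> K" if "t > 0" for t
    using g_bounds that by auto
  have prim_cmult: "primitive (\<lambda>t. c * h t) x = c * primitive h x" for c h x
    by (simp add: primitive_def)
  have f_anti: "antimono_on {0<..} f"
  proof (rule monotone_onI)
    fix s t :: real assume st: "s \<in> {0<..}" "t \<in> {0<..}" "s \<le> t"
    have "t powr (1 / p - 1) \<le> s powr (1 / p - 1)"
      using st \<open>p > 1\<close> by (intro powr_mono2') (auto simp: field_simps)
    moreover have "g t \<le> g s"
      using anti st by (auto simp: monotone_on_def)
    ultimately show "f s \<ge> f t"
      unfolding f_def using st g_pos[of t] by (intro mult_mono) auto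
  qed
  have pw: "integrable (lebesgue_on {0<..<x}) (\<lambda>t. c * t powr (1 / p - 1))"
    "x \<ge> 0 \<Longrightarrow> primitive (\<lambda>t. c * t powr (1 / p - 1)) x = c * p * x powr (1 / p)" for x c :: real
    using integral_powr[of "1 / p" x] \<open>p > 1\<close> by (auto simp: prim_cmult)
  have f_int: "integrable (lebesgue_on {0<..<x}) f" for x
  proof (rule Bochner_Integration.integrable_bound[OF pw(1)[of x K]])
    show "f \<in> borel_measurable (lebesgue_on {0<..<x})"
      by (rule antimono_on_borel_measurable[OF f_anti])
    have "norm (f t) \<le> norm (K * t powr (1 / p - 1))" if "t > 0" for t
      using g_pos[OF that] g_le[OF that] by (simp add: f_def abs_mult mult.commute mult_right_mono)
    then show "AE t in lebesgue_on {0<..<x}. norm (f t) \<le> norm (K * t powr (1 / p - 1))"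
      by (intro AE_I2) auto
  qed
  show "integrable (lebesgue_on {0<..<x}) f" by (rule f_int)
  show "concave_on {0..} (primitive f)"
    by (rule concave_on_if_supporting_lines) (use primitive_le_tangent[OF f_anti f_int] in blast)
  have upper: "primitive f x \<le> K * p * x powr (1 / p)" if "x \<ge> 0" for x
  proof -
    have "primitive f x \<le> primitive (\<lambda>t. K * t powr (1 / p - 1)) x"
      using g_le by (intro primitive_mono f_int pw) (auto simp: f_def mult.commute mult_right_mono)
    then show ?thesis
      using pw(2)[OF that] by simp
  qed
  show "x \<ge> 0 \<Longrightarrow> primitive f x \<le> K * p * x powr (1 / p)" by (rule upper)
  have lower: "primitive f x \<ge> p * (x powr (1 / p) * g x)" if "x > 0" for x
  proof -
    have "g x \<le> g t" if "0 < t" "t < x" for t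
      using anti that by (auto simp: monotone_on_def)
    then have "primitive (\<lambda>t. g x * t powr (1 / p - 1)) x \<le> primitive f x"
      by (intro primitive_mono f_int pw) (auto simp: f_def mult.commute mult_right_mono)
    then show ?thesis
      using pw(2)[of x "g x"] that by (simp add: mult_ac)
  qed
  have pos: "primitive f x > 0" if "x > 0" for x
  proof -
    have "p * (x powr (1 / p) * g x) > 0"
      using that g_pos \<open>p > 1\<close> by simp
    with lower[OF that] show ?thesis by linarith
  qed
  then show "\<forall>x>0. primitive f x > 0" by blast
  show "(primitive f \<longlongrightarrow> 0) (at_right 0)"
  proof (rule tendsto_sandwich)
    show "eventually (\<lambda>x. 0 \<le> primitive f x) (at_right 0)"
      using eventually_at_right_less[of 0] by eventually_elim (use pos in \<open>simp add: less_imp_le\<close>)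
    show "eventually (\<lambda>x. primitive f x \<le> K * p * x powr (1 / p)) (at_right 0)"
      using upper by (auto simp: eventually_at_right_field intro: exI[of _ 1])
    have "((\<lambda>x. x powr (1 / p)) \<longlongrightarrow> 0) (at_right 0)"
      using \<open>p > 1\<close>
      by (intro tendsto_zero_powrI[where b = "1 / p"] tendsto_ident_at tendsto_const)
        (auto simp: eventually_at_right_field intro: exI[of _ 1])
    then show "((\<lambda>x. K * p * x powr (1 / p)) \<longlongrightarrow> 0) (at_right 0)"
      by (rule tendsto_mult_right_zero)
  qed simp
  show "filterlim (primitive f) at_top at_top"
  proof (rule filterlim_at_top_mono)
    show "filterlim (\<lambda>x. p * (x powr (1 / p) * g x)) at_top at_top"
      using \<open>p > 1\<close> by (intro filterlim_tendsto_pos_mult_at_top[OF tendsto_const _ g_top]) auto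
    show "eventually (\<lambda>x. p * (x powr (1 / p) * g x) \<le> primitive f x) at_top"
      using eventually_gt_at_top[of 0] by eventually_elim (rule lower)
  qed
  show "eventually (\<lambda>x. primitive f x \<le> \<epsilon> * x powr (1 / p)) at_top" if "\<epsilon> > 0"
  proof -
    define q where "q = 1 / (2 * p)"
    have q: "q > 0" "1 / p = q + q" "1 / q = 2 * p"
      using \<open>p > 1\<close> by (auto simp: q_def field_simps)
    define \<delta> where "\<delta> = \<epsilon> / (2 * p)"
    have "\<delta> > 0"
      using that \<open>p > 1\<close> by (simp add: \<delta>_def)
    have "K \<ge> 0"
      using g_pos[of 1] g_le[of 1] by simp
    have "eventually (\<lambda>t. g t < \<delta>) at_top"
      using order_tendstoD(2)[OF g_lim \<open>\<delta> > 0\<close>] .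
    then obtain Y0 where Y0: "\<forall>t\<ge>Y0. g t < \<delta>"
      unfolding eventually_at_top_linorder by blast
    define Y where "Y = max 1 Y0"
    have Y: "Y \<ge> 1" "\<And>t. t \<ge> Y \<Longrightarrow> g t \<le> \<delta>"
      using Y0 by (auto simp: Y_def less_imp_le)
    \<comment> \<open>For \<open>t < Y\<close> the factor \<open>(Y / t) powr q\<close> exceeds \<open>1\<close>, so \<open>K * (Y / t) powr q\<close> absorbs the
      bound \<open>K\<close> of \<open>g\<close>; it integrates to a power \<open>q\<close> below \<open>1 / p\<close>.\<close>
    define c where "c = K * Y powr q"
    have g_le2: "g t \<le> \<delta> + c * t powr (- q)" if "t > 0" for t
    proof (cases "t \<ge> Y")
      case True
      then show ?thesis
        using Y(2)[OF True] \<open>K \<ge> 0\<close> by (auto simp: c_def intro: add_increasing2)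
    next
      case False
      have "1 \<le> (Y / t) powr q"
        using False that q by (intro ge_one_powr_ge_zero) auto
      also have "\<dots> = Y powr q * t powr (- q)"
        using that Y(1) by (simp add: powr_divide powr_minus_divide)
      finally have "K * 1 \<le> K * (Y powr q * t powr (- q))"
        using \<open>K \<ge> 0\<close> by (intro mult_left_mono)
      then show ?thesis
        using g_le[OF that] \<open>\<delta> > 0\<close> by (simp add: c_def mult.assoc)
    qed
    have bound: "primitive f x \<le> \<delta> * p * x powr (1 / p) + 2 * p * c * x powr q" if "x > 0" for x
    proof -
      have I: "integrable (lebesgue_on {0<..<x}) (\<lambda>t. c * t powr (q - 1))"
        using integral_powr(1)[OF q(1), of x] by simp
      have "primitive f x \<le> primitive (\<lambda>t. \<delta> * t powr (1 / p - 1) + c * t powr (q - 1)) x"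
      proof (rule primitive_mono)
        fix t :: real assume "0 < t"
        have "f t \<le> t powr (1 / p - 1) * (\<delta> + c * t powr (- q))"
          unfolding f_def using g_le2[OF \<open>0 < t\<close>] by (intro mult_left_mono) auto
        also have "\<dots> = \<delta> * t powr (1 / p - 1) + c * (t powr (1 / p - 1) * t powr (- q))"
          by (simp add: algebra_simps)
        also have "t powr (1 / p - 1) * t powr (- q) = t powr (q - 1)"
          using q(2) by (simp add: powr_add[symmetric])
        finally show "f t \<le> \<delta> * t powr (1 / p - 1) + c * t powr (q - 1)" .
      qed (intro f_int Bochner_Integration.integrable_add pw I)+
      also have "\<dots> = primitive (\<lambda>t. \<delta> * t powr (1 / p - 1)) x + primitive (\<lambda>t. c * t powr (q - 1)) x"
        unfolding primitive_def using pw(1) I by (intro Bochner_Integration.integral_add)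
      also have "\<dots> = \<delta> * p * x powr (1 / p) + c * (x powr q / q)"
        using pw(2)[of x \<delta>] integral_powr(2)[OF q(1), of x] that by (simp add: prim_cmult)
      also have "x powr q / q = 2 * p * x powr q"
        by (simp add: q_def)
      finally show ?thesis by (simp add: mult_ac)
    qed
    have "filterlim (\<lambda>x. \<epsilon> / 2 * x powr q) at_top at_top"
      using \<open>\<epsilon> > 0\<close> q(1)
      by (intro filterlim_tendsto_pos_mult_at_top[OF tendsto_const] real_powr_at_top) auto
    then have "eventually (\<lambda>x. \<epsilon> / 2 * x powr q \<ge> 2 * p * c) at_top"
      unfolding filterlim_at_top by blast
    then show ?thesis
      using eventually_gt_at_top[of 0]
    proof eventually_elim
      case (elim x)
      have "primitive f x \<le> \<epsilon> / 2 * x powr (1 / p) + (2 * p * c) * x powr q"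
        using bound[OF elim(2)] \<open>p > 1\<close> by (simp add: \<delta>_def)
      also have "(2 * p * c) * x powr q \<le> (\<epsilon> / 2 * x powr q) * x powr q"
        using elim(1) by (intro mult_right_mono) auto
      also have "\<dots> = \<epsilon> / 2 * x powr (1 / p)"
        unfolding q(2) powr_add by simp
      finally show ?case by simp
    qed
  qed
qed

section \<open>The perspective of a primitive\<close>

text \<open>
  Inserting \<open>1 / x\<close> into the tangent inequality of the primitive and multiplying by \<open>x\<close> turns a line
  into a line again. The new line has the value \<open>m\<close> at \<open>0\<close>, where \<open>B\<close> vanishes; there the sign of
  the integrand is what counts.
\<close>

lemma perspective_properties:
  fixes w :: "real \<Rightarrow> real" and K :: real
  defines "B \<equiv> \<lambda>x. x * primitive w (1 / x)"
  assumes anti: "antimono_on {0<..} w" and int: "\<And>x. integrable (lebesgue_on {0<..<x}) w"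
    and w_nonneg: "\<And>t. t > 0 \<Longrightarrow> w t \<ge> 0" and le: "\<And>x. x > 0 \<Longrightarrow> primitive w x \<le> K"
    and pos: "\<And>x. x > 0 \<Longrightarrow> primitive w x > 0"
  shows "concave_on {0..} B" and "(B \<longlongrightarrow> 0) (at_right 0)"
proof -
  show "concave_on {0..} B"
  proof (rule concave_on_if_supporting_lines)
    fix c :: real assume "c > 0"
    define m where "m = w (1 / c)"
    have "m \<ge> 0"
      using w_nonneg \<open>c > 0\<close> by (simp add: m_def)
    have "B x \<le> B c + (primitive w (1 / c) - m / c) * (x - c)" if "x \<ge> 0" for x
    proof (cases "x = 0")
      case True
      then show ?thesis
        using \<open>m \<ge> 0\<close> \<open>c > 0\<close> by (simp add: B_def algebra_simps)
    next
      case False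
      have "primitive w (1 / x) \<le> primitive w (1 / c) + m * (1 / x - 1 / c)"
        unfolding m_def using \<open>c > 0\<close> that by (intro primitive_le_tangent[OF anti int]) auto
      then have "B x \<le> x * (primitive w (1 / c) + m * (1 / x - 1 / c))"
        unfolding B_def using that by (intro mult_left_mono) auto
      also have "\<dots> = B c + (primitive w (1 / c) - m / c) * (x - c)"
        using False \<open>c > 0\<close> by (simp add: B_def field_simps)
      finally show ?thesis .
    qed
    then show "\<exists>m. \<forall>x\<ge>0. B x \<le> B c + m * (x - c)"
      by blast
  qed
  show "(B \<longlongrightarrow> 0) (at_right 0)"
  proof (rule tendsto_sandwich)
    show "eventually (\<lambda>x. 0 \<le> B x) (at_right 0)"
      using eventually_at_right_less[of 0]
      by eventually_elim (use pos in \<open>simp add: B_def less_imp_le\<close>)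
    show "eventually (\<lambda>x. B x \<le> x * K) (at_right 0)"
      using eventually_at_right_less[of 0]
      by eventually_elim (use le in \<open>simp add: B_def mult_left_mono\<close>)
    show "((\<lambda>x. x * K) \<longlongrightarrow> 0) (at_right 0)"
      by (auto intro!: tendsto_eq_intros)
  qed simp
qed

section \<open>Orlicz spaces and Lebesgue spaces\<close>

lemma orlicz_space_iff:
  "f \<in> orlicz_space C T \<longleftrightarrow> f \<in> borel_measurable (lebesgue_on {0<..<T}) \<and>
    (\<exists>l>0. (\<integral>\<^sup>+ t. ennreal (C (\<bar>f t\<bar> / l)) \<partial>lebesgue_on {0<..<T}) \<le> 1)"
  unfolding orlicz_space_def luxemburg_norm_def by (auto simp: Inf_less_iff ennreal_less_top)

text \<open>
  The hypothesis says \<open>x powr p \<le> k powr p * C x\<close>, but in the form in which it comes from an upper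
  bound for the inverse of \<open>C\<close>.
\<close>

lemma orlicz_space_subset_Lp_space:
  fixes p k :: real
  assumes "p > 0" "k > 0" and C_nonneg: "\<And>x. x \<ge> 0 \<Longrightarrow> C x \<ge> 0"
    and C_ge: "\<And>x. x \<ge> 0 \<Longrightarrow> x \<le> k * C x powr (1 / p)"
  shows "orlicz_space C T \<subseteq> Lp_space p T"
proof
  fix f assume "f \<in> orlicz_space C T"
  then obtain l where f: "f \<in> borel_measurable (lebesgue_on {0<..<T})" and "l > 0"
    and l: "(\<integral>\<^sup>+ t. ennreal (C (\<bar>f t\<bar> / l)) \<partial>lebesgue_on {0<..<T}) \<le> 1"
    unfolding orlicz_space_iff by blast
  define c where "c = (l * k) powr p"
  have "c > 0"
    using assms \<open>l > 0\<close> by (simp add: c_def)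
  have bound: "\<bar>f t\<bar> powr p / c \<le> C (\<bar>f t\<bar> / l)" for t
  proof -
    have "\<bar>f t\<bar> / l \<le> k * C (\<bar>f t\<bar> / l) powr (1 / p)"
      using \<open>l > 0\<close> by (intro C_ge) auto
    then have "\<bar>f t\<bar> \<le> (l * k) * C (\<bar>f t\<bar> / l) powr (1 / p)"
      using \<open>l > 0\<close> by (simp add: field_simps)
    then have "\<bar>f t\<bar> powr p \<le> ((l * k) * C (\<bar>f t\<bar> / l) powr (1 / p)) powr p"
      using \<open>p > 0\<close> by (intro powr_mono2) auto
    also have "\<dots> = c * C (\<bar>f t\<bar> / l)"
      using \<open>l > 0\<close> \<open>k > 0\<close> \<open>p > 0\<close> C_nonneg[of "\<bar>f t\<bar> / l"]
      by (simp add: c_def powr_mult powr_powr)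
    finally show ?thesis
      using \<open>c > 0\<close> by (simp add: field_simps)
  qed
  have "integrable (lebesgue_on {0<..<T}) (\<lambda>t. \<bar>f t\<bar> powr p / c)"
  proof (rule integrableI_bounded)
    show "(\<lambda>t. \<bar>f t\<bar> powr p / c) \<in> borel_measurable (lebesgue_on {0<..<T})"
      using f by measurable
    have "(\<integral>\<^sup>+ t. ennreal (norm (\<bar>f t\<bar> powr p / c)) \<partial>lebesgue_on {0<..<T})
        \<le> (\<integral>\<^sup>+ t. ennreal (C (\<bar>f t\<bar> / l)) \<partial>lebesgue_on {0<..<T})"
      using bound \<open>c > 0\<close> by (intro nn_integral_mono ennreal_leI) simp
    also have "\<dots> < \<infinity>"
      using l by (auto simp: top_unique intro: le_less_trans)
    finally show "(\<integral>\<^sup>+ t. ennreal (norm (\<bar>f t\<bar> powr p / c)) \<partial>lebesgue_on {0<..<T}) < \<infinity>" .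
  qed
  then have "integrable (lebesgue_on {0<..<T}) (\<lambda>t. c * (\<bar>f t\<bar> powr p / c))"
    by (rule integrable_mult_right)
  then show "f \<in> Lp_space p T"
    using f \<open>c > 0\<close> by (simp add: Lp_space_def)
qed

lemma young_function_mono:
  assumes "young_function C" "0 \<le> x" "x \<le> y"
  shows "C x \<le> C y"
proof (cases "y = 0")
  case False
  have "C ((1 - x / y) *\<^sub>R 0 + (x / y) *\<^sub>R y) \<le> (1 - x / y) * C 0 + (x / y) * C y"
    using assms False unfolding young_function_def
    by (intro convex_onD[of "{0..}"]) (auto simp: divide_simps)
  then have "C x \<le> (x / y) * C y"
    using assms False by (simp add: young_function_def)
  also have "\<dots> \<le> 1 * C y"
    using assms False unfolding young_function_def
    by (intro mult_right_mono) (auto simp: divide_simps less_imp_le)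
  finally show ?thesis by simp
qed (use assms in auto)

text \<open>
  A gliding hump. Choose heights \<open>x n\<close> with \<open>C (x n / (n + 1))\<close> far above \<open>x n powr p\<close>, and lengths
  \<open>e n\<close> such that the hump of height \<open>x n\<close> on \<open>(0, e n)\<close> has \<open>p\<close>-th power integral \<open>T / 2 ^ n\<close>. The sum
  of the \<open>p\<close>-th powers of all humps is integrable, and its \<open>p\<close>-th root \<open>f\<close> dominates each hump almost
  everywhere. For every \<open>l\<close> the single hump with \<open>n + 1 \<ge> l\<close> already forces the integral of
  \<open>C (f / l)\<close> above \<open>1\<close>. As only one hump is used at a time, the supports may overlap.
\<close>

lemma exists_Lp_not_orlicz:
  fixes p T :: real
  assumes C: "young_function C" and "p > 0" "T > 0"
    and big: "\<And>M. \<exists>z\<ge>1. C z > M * z powr p"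
  shows "\<exists>f\<in>Lp_space p T. f \<notin> orlicz_space C T"
proof -
  let ?M = "lebesgue_on {0<..<T}"
  have "\<exists>x\<ge>1. C (x / Suc n) > 2 ^ n * x powr p / T" for n
  proof -
    obtain z where z: "z \<ge> 1" "C z > (2 ^ n * real (Suc n) powr p / T) * z powr p"
      using big by blast
    show ?thesis
    proof (intro exI conjI)
      show "1 \<le> real (Suc n) * z"
        using z mult_mono[of 1 "real (Suc n)" 1 z] by simp
      show "C ((real (Suc n) * z) / Suc n) > 2 ^ n * (real (Suc n) * z) powr p / T"
        using z by (simp add: powr_mult del: of_nat_Suc)
    qed
  qed
  then obtain x where x1: "\<And>n. x n \<ge> 1" and xC: "\<And>n. C (x n / Suc n) > 2 ^ n * x n powr p / T"
    by metis
  define e where "e n = T / (2 ^ n * x n powr p)" for n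
  have x0: "x n powr p \<ge> 1" for n
    using x1 \<open>p > 0\<close> by (simp add: ge_one_powr_ge_zero)
  have prod1: "2 ^ n * x n powr p \<ge> 1" for n
    using mult_mono[of 1 "2 ^ n" 1 "x n powr p"] x0 by simp
  have e0: "e n > 0" for n
    using \<open>T > 0\<close> prod1[of n] unfolding e_def by (intro divide_pos_pos) auto
  have eT: "e n \<le> T" for n
    using \<open>T > 0\<close> prod1[of n] divide_left_mono[of 1 "2 ^ n * x n powr p" T] by (simp add: e_def)
  define F where "F t = (\<Sum>n. ennreal (x n powr p) * indicator {0<..<e n} t)" for t
  have meas_set [measurable]: "{0<..<e n} \<in> sets ?M" for n
    using eT[of n] by (auto simp: sets_restrict_space_iff)
  have em: "emeasure ?M {0<..<e n} = ennreal (e n)" for n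
    using eT[of n] e0[of n] by (subst emeasure_restrict_space) auto
  have F_meas [measurable]: "F \<in> borel_measurable ?M"
    unfolding F_def by measurable
  have "(\<integral>\<^sup>+ t. F t \<partial>?M) = (\<Sum>n. ennreal (x n powr p) * ennreal (e n))"
    unfolding F_def using meas_set em
    by (subst nn_integral_suminf) (auto simp: nn_integral_cmult)
  also have "\<dots> = (\<Sum>n. ennreal (T * (1 / 2) ^ n))"
  proof (intro suminf_cong)
    fix n
    have "x n powr p * e n = T * (1 / 2) ^ n"
      using x0[of n] x1[of n] by (simp add: e_def field_simps)
    then show "ennreal (x n powr p) * ennreal (e n) = ennreal (T * (1 / 2) ^ n)"
      using e0[of n] by (simp add: ennreal_mult'[symmetric])
  qed
  also have "\<dots> = ennreal (\<Sum>n. T * (1 / 2) ^ n)"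
    using \<open>T > 0\<close> by (intro suminf_ennreal2 summable_mult summable_geometric) auto
  finally have F_fin: "(\<integral>\<^sup>+ t. F t \<partial>?M) < \<infinity>"
    by simp
  define f where "f t = enn2real (F t) powr (1 / p)" for t
  have f_meas: "f \<in> borel_measurable ?M"
    unfolding f_def by measurable
  have "integrable ?M (\<lambda>t. enn2real (F t))"
  proof (rule integrableI_bounded)
    have "(\<integral>\<^sup>+ t. ennreal (norm (enn2real (F t))) \<partial>?M) \<le> (\<integral>\<^sup>+ t. F t \<partial>?M)"
      by (intro nn_integral_mono) (auto simp: ennreal_enn2real_if)
    then show "(\<integral>\<^sup>+ t. ennreal (norm (enn2real (F t))) \<partial>?M) < \<infinity>"
      using F_fin by (rule le_less_trans)
  qed measurable
  then have "f \<in> Lp_space p T"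
    using f_meas \<open>p > 0\<close> by (simp add: Lp_space_def f_def powr_powr)
  moreover have "f \<notin> orlicz_space C T"
  proof
    assume "f \<in> orlicz_space C T"
    then obtain l where "l > 0" and l: "(\<integral>\<^sup>+ t. ennreal (C (\<bar>f t\<bar> / l)) \<partial>?M) \<le> 1"
      unfolding orlicz_space_iff by blast
    obtain n where n: "l \<le> real (Suc n)"
      by (metis less_imp_le real_arch_simple le_SucI of_nat_le_iff order_trans le_refl)
    have "AE t in ?M. F t \<noteq> \<infinity>"
      using F_fin by (intro nn_integral_PInf_AE) auto
    then have "AE t in ?M. ennreal (C (x n / Suc n)) * indicator {0<..<e n} t
        \<le> ennreal (C (\<bar>f t\<bar> / l))"
    proof eventually_elim
      case (elim t)
      show ?case
      proof (cases "t \<in> {0<..<e n}")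
        case True
        define h where "h = (\<lambda>k. ennreal (x k powr p) * indicator {0<..<e k} t)"
        have "sum h {n} \<le> suminf h"
          by (rule sum_le_suminf) auto
        then have "h n \<le> F t"
          by (simp add: F_def flip: h_def)
        then have "ennreal (x n powr p) \<le> F t"
          using True by (simp add: h_def)
        then have "x n powr p \<le> enn2real (F t)"
          using elim by (metis enn2real_ennreal enn2real_mono infinity_ennreal_def powr_ge_zero top.not_eq_extremum)
        then have "(x n powr p) powr (1 / p) \<le> f t"
          unfolding f_def using \<open>p > 0\<close> by (intro powr_mono2) auto
        then have "x n \<le> f t"
          using \<open>p > 0\<close> x1[of n] by (simp add: powr_powr)
        then have "x n / Suc n \<le> \<bar>f t\<bar> / l"
          using n \<open>l > 0\<close> x1[of n] by (intro frac_le) auto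
        then have "C (x n / Suc n) \<le> C (\<bar>f t\<bar> / l)"
          using x1[of n] by (intro young_function_mono[OF C]) auto
        then show ?thesis
          using True by (simp add: ennreal_leI)
      qed auto
    qed
    then have "(\<integral>\<^sup>+ t. ennreal (C (x n / Suc n)) * indicator {0<..<e n} t \<partial>?M) \<le> 1"
      using l by (rule order_trans[OF nn_integral_mono_AE])
    then have "ennreal (C (x n / Suc n)) * ennreal (e n) \<le> 1"
      using meas_set[of n] em[of n] by (simp add: nn_integral_cmult_indicator)
    then have "C (x n / Suc n) * e n \<le> 1"
      using e0[of n] by (simp add: ennreal_mult''[symmetric])
    moreover have "(2 ^ n * x n powr p / T) * e n = 1"
      using x1[of n] \<open>T > 0\<close> by (simp add: e_def)
    moreover have "(2 ^ n * x n powr p / T) * e n < C (x n / Suc n) * e n"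
      using xC e0 by (intro mult_strict_right_mono)
    ultimately show False by linarith
  qed
  ultimately show ?thesis by blast
qed

section \<open>Strict inclusion for a prescribed decreasing weight\<close>

theorem proposition4p1:
  fixes p T \<tau>\<^sub>0 :: real and \<nu> :: "real \<Rightarrow> real"
  assumes "1 < p" and "0 < T"
    and "integrable (lebesgue_on {0<..<T}) \<nu>"
    and "\<forall>t\<in>{0<..<T}. \<nu> t > 0"
    and "0 < \<tau>\<^sub>0" and "\<tau>\<^sub>0 \<le> T"
    and "antimono_on {0<..<\<tau>\<^sub>0} \<nu>"
    and "\<tau>\<^sub>0 < T \<longrightarrow> bounded (\<nu> ` {\<tau>\<^sub>0<..<T})"
  shows "\<exists>A. young_function A \<and>
    (\<exists>c>0. \<forall>t\<in>{0<..<\<tau>\<^sub>0}.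
       integral\<^sup>L (lebesgue_on {0<..<t}) \<nu> \<le> c * t * young_inv A (1 / t)) \<and>
    (\<exists>C. young_function C \<and>
       (\<forall>x\<ge>0. integrable (lebesgue_on {0<..<x}) (\<lambda>t. t powr (- 2 + 1 / p) * young_inv A t) \<and>
          young_inv C x =
            integral\<^sup>L (lebesgue_on {0<..<x}) (\<lambda>t. t powr (- 2 + 1 / p) * young_inv A t)) \<and>
       orlicz_space C T \<subset> Lp_space p T)"
proof -
  define q where "q = 1 / (2 * p)"
  have q: "0 < q" "q < 1" "1 / p = q + q"
    using \<open>1 < p\<close> by (auto simp: q_def field_simps)
  \<comment> \<open>The cut-off keeps \<open>w\<close> decreasing, because \<open>\<nu>\<close> is positive on \<open>(0,\<tau>\<^sub>0)\<close>.\<close>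
  define w where "w t = indicator {0<..<\<tau>\<^sub>0} t * (\<nu> t + t powr (q - 1))" for t
  have \<nu>_pos: "\<nu> t > 0" if "0 < t" "t < \<tau>\<^sub>0" for t
    using assms(4,6) that by auto
  have w_nonneg: "w t \<ge> 0" for t
    using \<nu>_pos[of t] by (auto simp: w_def indicator_def add_nonneg_nonneg less_imp_le)
  have w_anti: "antimono_on {0<..} w"
  proof (rule monotone_onI)
    fix s t :: real assume st: "s \<in> {0<..}" "t \<in> {0<..}" "s \<le> t"
    show "w s \<ge> w t"
    proof (cases "t < \<tau>\<^sub>0")
      case True
      then have "\<nu> t \<le> \<nu> s"
        using assms(7) st by (auto simp: monotone_on_def)
      moreover have "t powr (q - 1) \<le> s powr (q - 1)"
        using q st by (intro powr_mono2') auto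
      ultimately show ?thesis
        using st True by (simp add: w_def)
    next
      case False
      then have "w t = 0"
        by (simp add: w_def)
      with w_nonneg show ?thesis by simp
    qed
  qed
  have \<nu>_int: "integrable (lebesgue_on {0<..<t}) \<nu>" if "t \<le> T" for t
  proof -
    have "integrable lebesgue (\<lambda>s. indicator {0<..<t} s * (indicator {0<..<T} s * \<nu> s))"
      using assms(3) integrable_mult_indicator[of "{0<..<t}" lebesgue "\<lambda>s. indicator {0<..<T} s * \<nu> s"]
      by (simp add: integrable_lebesgue_on_iff)
    also have "(\<lambda>s. indicator {0<..<t} s * (indicator {0<..<T} s * \<nu> s)) =
        (\<lambda>s. indicator {0<..<t} s * \<nu> s)"
      using that by (auto simp: indicator_def fun_eq_iff)
    finally show ?thesis
      by (simp add: integrable_lebesgue_on_iff)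
  qed
  have w_int: "integrable lebesgue w"
  proof -
    have "integrable (lebesgue_on {0<..<\<tau>\<^sub>0}) (\<lambda>t. \<nu> t + t powr (q - 1))"
      using \<nu>_int[OF \<open>\<tau>\<^sub>0 \<le> T\<close>] integral_powr(1)[OF q(1)] by simp
    then show ?thesis
      unfolding integrable_lebesgue_on_iff by (simp add: w_def[abs_def])
  qed
  have w_int': "integrable (lebesgue_on {0<..<x}) w" for x
    using w_int integrable_mult_indicator[of "{0<..<x}" lebesgue w]
    by (simp add: integrable_lebesgue_on_iff)
  define K where "K = (LINT t|lebesgue. w t)"
  have N_le: "primitive w x \<le> K" for x
    unfolding primitive_eq_indicator K_def using w_int w_int' w_nonneg
    by (intro integral_mono) (auto simp: integrable_lebesgue_on_iff indicator_def)
  have N_ge: "x powr q / q \<le> primitive w x" if "0 < x" "x \<le> \<tau>\<^sub>0" for x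
  proof -
    have "t powr (q - 1) \<le> w t" if "0 < t" "t < x" for t
      using that \<open>x \<le> \<tau>\<^sub>0\<close> \<nu>_pos[of t] by (simp add: w_def)
    then have "primitive (\<lambda>t. t powr (q - 1)) x \<le> primitive w x"
      by (intro primitive_mono integral_powr q w_int') auto
    then show ?thesis
      using integral_powr(2)[OF q(1), of x] that by simp
  qed
  have N_mono: "primitive w x \<le> primitive w y" if "x \<le> y" for x y
    using that w_nonneg by (intro primitive_mono_upper_limit w_int') auto
  have N_pos: "primitive w x > 0" if "x > 0" for x
  proof -
    have "0 < min x \<tau>\<^sub>0 powr q / q"
      using that \<open>0 < \<tau>\<^sub>0\<close> q by simp
    also have "\<dots> \<le> primitive w (min x \<tau>\<^sub>0)"
      using that \<open>0 < \<tau>\<^sub>0\<close> by (intro N_ge) auto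
    also have "\<dots> \<le> primitive w x"
      by (intro N_mono) simp
    finally show ?thesis .
  qed

  define B where "B = (\<lambda>x. x * primitive w (1 / x))"
  define A where "A = inv_into {0..} B"
  have B_ge: "eventually (\<lambda>x. x powr (1 - q) / q \<le> B x) at_top"
    using eventually_ge_at_top[of "1 / \<tau>\<^sub>0"] eventually_gt_at_top[of 0]
  proof eventually_elim
    case (elim x)
    have "x powr (1 - q) / q = x * ((1 / x) powr q / q)"
      using elim by (simp add: powr_diff powr_divide)
    also have "\<dots> \<le> B x"
      unfolding B_def using elim \<open>0 < \<tau>\<^sub>0\<close> by (intro mult_left_mono N_ge) (auto simp: field_simps)
    finally show ?case .
  qed
  have B_top: "filterlim B at_top at_top"
  proof (rule filterlim_at_top_mono[OF _ B_ge])
    have "filterlim (\<lambda>x. 1 / q * x powr (1 - q)) at_top at_top"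
      using q by (intro filterlim_tendsto_pos_mult_at_top[OF tendsto_const] real_powr_at_top) auto
    then show "filterlim (\<lambda>x. x powr (1 - q) / q) at_top at_top"
      by simp
  qed
  have B_pos: "\<forall>x>0. B x > 0"
    using N_pos by (simp add: B_def)
  have B_props: "concave_on {0..} B" "(B \<longlongrightarrow> 0) (at_right 0)"
    unfolding B_def by (rule perspective_properties[OF w_anti w_int' w_nonneg N_le N_pos]; assumption)+
  have "B 0 = 0"
    by (simp add: B_def)
  have A: "young_function A" "\<And>x. x \<ge> 0 \<Longrightarrow> young_inv A x = B x"
    unfolding A_def
    by (rule inverse_of_concave_is_young_function[OF B_props(1) \<open>B 0 = 0\<close> B_pos B_props(2) B_top]; assumption)+

  define g where "g t = primitive w (1 / t)" for t
  have g_anti: "antimono_on {0<..} g"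
    by (rule monotone_onI) (auto simp: g_def intro!: N_mono divide_left_mono)
  have g_bounds: "\<forall>t>0. 0 < g t \<and> g t \<le> K"
    using N_pos N_le by (simp add: g_def)
  have g_lim: "(g \<longlongrightarrow> 0) at_top"
  proof -
    have "((\<lambda>x. LINT t|lebesgue. indicator {0<..<1 / x} t * w t) \<longlongrightarrow> (LINT (t::real)|lebesgue. 0)) at_top"
    proof (rule integral_dominated_convergence_at_top)
      show "(\<lambda>t. indicator {0<..<1 / x} t * w t) \<in> borel_measurable lebesgue" for x
        using w_int'[of "1 / x"] unfolding integrable_lebesgue_on_iff by (rule borel_measurable_integrable)
      show "AE t in lebesgue. ((\<lambda>x. indicator {0<..<1 / x} t * w t) \<longlongrightarrow> 0) at_top"
      proof (intro AE_I2 tendsto_eventually)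
        fix t :: real
        show "eventually (\<lambda>x. indicator {0<..<1 / x} t * w t = 0) at_top"
        proof (cases "t > 0")
          case True
          show ?thesis
            using eventually_ge_at_top[of "1 / t"] eventually_gt_at_top[of 0]
            by eventually_elim (use True in \<open>auto simp: field_simps indicator_def\<close>)
        qed (simp add: indicator_def)
      qed
      show "eventually (\<lambda>x. AE t in lebesgue. norm (indicator {0<..<1 / x} t * w t) \<le> w t) at_top"
        using w_nonneg by (intro always_eventually allI AE_I2) (auto simp: indicator_def)
    qed (use w_int in auto)
    then show ?thesis
      by (simp add: g_def[abs_def] primitive_eq_indicator)
  qed
  have g_top: "filterlim (\<lambda>x. x powr (1 / p) * g x) at_top at_top"
  proof (rule filterlim_at_top_mono)
    have "filterlim (\<lambda>x. 1 / q * x powr q) at_top at_top"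
      using q by (intro filterlim_tendsto_pos_mult_at_top[OF tendsto_const] real_powr_at_top) auto
    then show "filterlim (\<lambda>x. x powr q / q) at_top at_top"
      by simp
    show "eventually (\<lambda>x. x powr q / q \<le> x powr (1 / p) * g x) at_top"
      using eventually_ge_at_top[of "1 / \<tau>\<^sub>0"] eventually_gt_at_top[of 0]
    proof eventually_elim
      case (elim x)
      have "x powr q / q = x powr (1 / p) * ((1 / x) powr q / q)"
        unfolding q(3) powr_add using elim by (simp add: powr_divide)
      also have "\<dots> \<le> x powr (1 / p) * g x"
        unfolding g_def using elim \<open>0 < \<tau>\<^sub>0\<close>
        by (intro mult_left_mono N_ge) (auto simp: field_simps)
      finally show ?case .
    qed
  qed

  define f where "f = (\<lambda>t. t powr (1 / p - 1) * g t)"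
  define D where "D = primitive f"
  define C where "C = inv_into {0..} D"
  note D_props = powr_primitive_properties[OF \<open>1 < p\<close> g_anti g_bounds g_lim g_top,
      folded f_def, folded D_def]
  have "D 0 = 0"
    by (simp add: D_def)
  note inv_D = inverse_of_concave_is_young_function[OF D_props(2) \<open>D 0 = 0\<close> D_props(3,5,6), folded C_def]
  have f_eq: "f t = t powr (- 2 + 1 / p) * young_inv A t" if "t > 0" for t
  proof -
    have "t powr (1 / p - 1) = t powr (- 2 + 1 / p) * t"
      using that powr_add[of t "- 2 + 1 / p" 1] by (simp add: algebra_simps)
    then show ?thesis
      using that A(2)[of t] by (simp add: f_def B_def g_def)
  qed
  have "orlicz_space C T \<subseteq> Lp_space p T"
  proof (rule orlicz_space_subset_Lp_space)
    show "p > 0" "K * p > 0"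
      using \<open>1 < p\<close> g_bounds[rule_format, of 1] by auto
    show "C x \<ge> 0" if "x \<ge> 0" for x
      using inv_D(4)[of x] that by simp
    show "x \<le> K * p * C x powr (1 / p)" if "x \<ge> 0" for x
      using D_props(4)[of "C x"] inv_D(4,5)[of x] that by simp
  qed
  moreover have "\<exists>h\<in>Lp_space p T. h \<notin> orlicz_space C T"
  proof (rule exists_Lp_not_orlicz[OF inv_D(1)])
    fix M :: real
    \<comment> \<open>The constants are chosen such that \<open>M' * \<epsilon> powr p = 1 / 2\<close>.\<close>
    define M' where "M' = max M 1"
    define \<epsilon> where "\<epsilon> = (1 / (2 * M')) powr (1 / p)"
    have "M' \<ge> 1"
      by (simp add: M'_def)
    then have "\<epsilon> > 0" and \<epsilon>_powr: "\<epsilon> powr p = 1 / (2 * M')"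
      using \<open>1 < p\<close> by (simp_all add: \<epsilon>_def powr_powr)
    have "eventually (\<lambda>y. D y \<le> \<epsilon> * y powr (1 / p) \<and> D y \<ge> 1 \<and> y > 0) at_top"
      using D_props(7)[OF \<open>\<epsilon> > 0\<close>] D_props(6)
      by (auto simp: filterlim_at_top eventually_conj_iff eventually_gt_at_top)
    then obtain y where y: "D y \<le> \<epsilon> * y powr (1 / p)" "D y \<ge> 1" "y > 0"
      using eventually_happens'[OF trivial_limit_at_top_linorder] by blast
    have "M * D y powr p \<le> M' * D y powr p"
      by (intro mult_right_mono) (auto simp: M'_def)
    also have "\<dots> \<le> M' * (\<epsilon> * y powr (1 / p)) powr p"
      using y \<open>1 < p\<close> by (intro mult_left_mono powr_mono2) (auto simp: M'_def)
    also have "\<dots> = M' * (\<epsilon> powr p * y)"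
      using y \<open>1 < p\<close> by (simp add: powr_mult powr_powr)
    also have "\<dots> < y"
      using y \<open>M' \<ge> 1\<close> by (simp add: \<epsilon>_powr)
    finally show "\<exists>z\<ge>1. C z > M * z powr p"
      using y inv_D(3)[of y] by (intro exI[of _ "D y"]) simp
  qed (use \<open>1 < p\<close> \<open>0 < T\<close> in simp_all)
  ultimately have "orlicz_space C T \<subset> Lp_space p T"
    by blast
  moreover have "\<forall>x\<ge>0. integrable (lebesgue_on {0<..<x}) (\<lambda>t. t powr (- 2 + 1 / p) * young_inv A t) \<and>
      young_inv C x = integral\<^sup>L (lebesgue_on {0<..<x}) (\<lambda>t. t powr (- 2 + 1 / p) * young_inv A t)"
  proof (intro allI impI conjI)
    fix x :: real assume "x \<ge> 0"
    have "integrable (lebesgue_on {0<..<x}) f \<longleftrightarrow>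
        integrable (lebesgue_on {0<..<x}) (\<lambda>t. t powr (- 2 + 1 / p) * young_inv A t)"
      by (intro Bochner_Integration.integrable_cong) (auto simp: f_eq)
    then show "integrable (lebesgue_on {0<..<x}) (\<lambda>t. t powr (- 2 + 1 / p) * young_inv A t)"
      using D_props(1)[of x] by simp
    have "integral\<^sup>L (lebesgue_on {0<..<x}) f =
        integral\<^sup>L (lebesgue_on {0<..<x}) (\<lambda>t. t powr (- 2 + 1 / p) * young_inv A t)"
      by (intro Bochner_Integration.integral_cong) (auto simp: f_eq)
    then show "young_inv C x = integral\<^sup>L (lebesgue_on {0<..<x}) (\<lambda>t. t powr (- 2 + 1 / p) * young_inv A t)"
      using inv_D(2)[of x] \<open>x \<ge> 0\<close> by (simp add: D_def primitive_def)
  qed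
  moreover have "\<forall>t\<in>{0<..<\<tau>\<^sub>0}.
      integral\<^sup>L (lebesgue_on {0<..<t}) \<nu> \<le> 1 * t * young_inv A (1 / t)"
  proof
    fix t assume t: "t \<in> {0<..<\<tau>\<^sub>0}"
    have "primitive \<nu> t \<le> primitive w t"
      using t \<open>\<tau>\<^sub>0 \<le> T\<close> by (intro primitive_mono \<nu>_int w_int') (auto simp: w_def)
    also have "\<dots> = t * young_inv A (1 / t)"
      using t by (simp add: A(2) B_def)
    finally show "integral\<^sup>L (lebesgue_on {0<..<t}) \<nu> \<le> 1 * t * young_inv A (1 / t)"
      by (simp add: primitive_def)
  qed
  ultimately show ?thesis
    using A(1) inv_D(1)
    by - (rule exI[of _ A], intro conjI, assumption, rule exI[of _ 1], intro conjI zero_less_one,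
        assumption, rule exI[of _ C], intro conjI, assumption+)
qed

end
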